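(* Let $n\ge 6$ be an even integer and let $$f_{n,2}(x)=2\sum_{j\geq 0}\binom{n-1}{2j+1}(x^j-x^{j+1})+2\sum_{j\geq 0}\binom{n}{2j}x^j\in\mathbb{Z}[x],\qquad C_n(x):=f_{n,2}(x)-2n\,x^{n/2-1}.$$ Then, with $N=n/2-1$, $C_n(x)$ (which has degree less than $N$) viewed as an element of $\mathbb{Z}[x]/(x^N-1)$ is a coterm polynomial.
   Context: For a commutative ring $R$ with identity and $N\ge1$, a polynomial $a_0+a_1x+\cdots+a_{N-1}x^{N-1}\in R[x]/(x^N-1)$ with $a_i\in R$ is a coterm polynomial if $a_i=a_{N-i}$ for all $1\le i\le\lfloor N/2\rfloor$. Binomial coefficients $\binom{a}{b}$ are $0$ when $b>a$. *)

theory Defs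
  imports "HOL-Computational_Algebra.Polynomial"
begin

text \<open>
  The ring \<open>R[x]/(x^N - 1)\<close> is represented by its underlying set
  \<open>UNIV // cyclic_rel N\<close> of residue classes of \<open>'a poly\<close>.
\<close>

definition cyclic_rel :: "nat \<Rightarrow> ('a::comm_ring_1 poly \<times> 'a poly) set" where
  "cyclic_rel N = {(p, q). (monom 1 N - 1) dvd (p - q)}"

definition cyclic_class :: "nat \<Rightarrow> 'a::comm_ring_1 poly \<Rightarrow> 'a poly set" where
  "cyclic_class N p = cyclic_rel N `` {p}"

lemma equiv_cyclic_rel: "equiv UNIV (cyclic_rel N)"
proof (rule equivI)
  show "refl_on UNIV (cyclic_rel N)"
    by (auto simp: refl_on_def cyclic_rel_def)
  show "sym (cyclic_rel N)"
    unfolding sym_def cyclic_rel_def by (auto, metis dvd_minus_iff minus_diff_eq)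
  show "trans (cyclic_rel N)"
  proof (rule transI)
    fix p q r assume "(p, q) \<in> cyclic_rel N" "(q, r) \<in> cyclic_rel N"
    then have "(monom 1 N - 1) dvd ((p - q) + (q - r))"
      unfolding cyclic_rel_def by (intro dvd_add) auto
    then show "(p, r) \<in> cyclic_rel N"
      by (simp add: cyclic_rel_def)
  qed
qed auto

lemma cyclic_class_eq_iff:
  "cyclic_class N p = cyclic_class N q \<longleftrightarrow> (monom 1 N - 1) dvd (p - q)"
  unfolding cyclic_class_def
  using eq_equiv_class_iff[OF equiv_cyclic_rel, of p q N] by (simp add: cyclic_rel_def)

text \<open>
  A predicate on residue classes, for \<open>N \<ge> 1\<close>. The coefficients \<open>a 0, \<dots>, a (N - 1)\<close> are
  determined by the class (lemma \<open>cyclic_class_coeffs_unique\<close>); every index \<open>N - i\<close> that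
  occurs is at most \<open>N - 1\<close> because \<open>i \<ge> 1\<close>.
\<close>

definition coterm :: "nat \<Rightarrow> 'a::comm_ring_1 poly set \<Rightarrow> bool" where
  "coterm N A \<longleftrightarrow>
     (\<exists>a :: nat \<Rightarrow> 'a. A = cyclic_class N (\<Sum>i<N. monom (a i) i) \<and>
        (\<forall>i. 1 \<le> i \<and> i \<le> N div 2 \<longrightarrow> a i = a (N - i)))"

lemma cyclic_class_coeffs_unique:
  fixes a b :: "nat \<Rightarrow> 'a::comm_ring_1"
  assumes eq: "cyclic_class N (\<Sum>i<N. monom (a i) i) = cyclic_class N (\<Sum>i<N. monom (b i) i)"
    and i: "i < N"
  shows "a i = b i"
proof -
  define d where "d = (\<Sum>i<N. monom (a i) i) - (\<Sum>i<N. monom (b i) i)"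
  have cd: "coeff d k = (if k < N then a k - b k else 0)" for k
    by (simp add: d_def coeff_sum)
  from eq obtain q where q: "d = (monom 1 N - 1) * q"
    unfolding d_def cyclic_class_eq_iff by (auto simp: dvd_def)
  have "q = 0"
  proof (rule ccontr)
    assume nz: "q \<noteq> 0"
    have "coeff d (N + degree q) = coeff (monom 1 N * q - q) (N + degree q)"
      by (simp add: q algebra_simps)
    also have "\<dots> = lead_coeff q - coeff q (N + degree q)"
      by (simp add: coeff_monom_mult)
    also have "\<dots> = lead_coeff q"
      using i by (simp add: coeff_eq_0)
    finally show False
      using nz cd[of "N + degree q"] by simp
  qed
  then have "coeff d i = 0"
    by (simp add: q)
  with cd[of i] i show ?thesis
    by simp
qed

text \<open>
  The two sums run over all \<open>j \<ge> 0\<close> in the source; the terms with \<open>j > n\<close> vanish.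
\<close>

definition f2 :: "nat \<Rightarrow> int poly" where
  "f2 n = 2 * (\<Sum>j\<le>n. of_nat ((n - 1) choose (2 * j + 1)) * (monom 1 j - monom 1 (j + 1)))
        + 2 * (\<Sum>j\<le>n. of_nat (n choose (2 * j)) * monom 1 j)"

lemma f2_bound_irrelevant:
  assumes "n \<le> m"
  shows "f2 n = 2 * (\<Sum>j\<le>m. of_nat ((n - 1) choose (2 * j + 1)) * (monom 1 j - monom 1 (j + 1)))
        + 2 * (\<Sum>j\<le>m. of_nat (n choose (2 * j)) * monom 1 j)"
proof -
  have "(\<Sum>j\<le>n. of_nat ((n - 1) choose (2 * j + 1)) * (monom 1 j - monom 1 (j + 1)))
      = (\<Sum>j\<le>m. of_nat ((n - 1) choose (2 * j + 1)) * (monom 1 j - monom 1 (j + 1)) :: int poly)"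
    using assms by (intro sum.mono_neutral_left) (auto simp: binomial_eq_0)
  moreover have "(\<Sum>j\<le>n. of_nat (n choose (2 * j)) * monom 1 j)
      = (\<Sum>j\<le>m. of_nat (n choose (2 * j)) * monom 1 j :: int poly)"
    using assms by (intro sum.mono_neutral_left) (auto simp: binomial_eq_0)
  ultimately show ?thesis
    by (simp add: f2_def)
qed

definition C_poly :: "nat \<Rightarrow> int poly" where
  "C_poly n = f2 n - monom (2 * int n) (n div 2 - 1)"

end

theory Submission imports Defs begin

text \<open>
  Two applications of Pascal's rule show that the coefficient of \<open>x^j\<close> in \<open>f2 n\<close> is
  \<open>2 * (n choose (2 * j + 1))\<close>. For \<open>n = 2 * N + 2\<close> the reflection
  \<open>2 * j + 1 \<mapsto> n - (2 * j + 1)\<close> of the binomial coefficients is \<open>j \<mapsto> N - j\<close>, and the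
  monomial subtracted in \<open>C_poly n\<close> cancels exactly the coefficient of \<open>x^N\<close>.
\<close>

lemma coeff_of_nat_mult: "coeff (of_nat k * p) i = of_nat k * coeff p i"
  by (simp add: of_nat_poly)

lemma coeff_f2:
  assumes "n \<ge> 1"
  shows "coeff (f2 n) i = 2 * int (n choose (2 * i + 1))"
proof -
  obtain m where m: "n = Suc m"
    using assms by (cases n) auto
  have coeff_two: "coeff (2 * p) i = 2 * coeff p i" for p :: "int poly"
    using coeff_of_nat_mult[of 2 p i] by simp
  \<comment> \<open>At \<open>Suc j = i\<close> the index \<open>2 * j + 1\<close> equals
    \<open>2 * i - 1\<close>; for \<open>i = 0\<close> this case never occurs, so the truncated
    subtraction is harmless.\<close>
  have summand: "coeff (of_nat ((n - 1) choose (2 * j + 1)) * (monom 1 j - monom 1 (j + 1))) i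
      = (if j = i then int (m choose (2 * i + 1)) else 0)
        - (if Suc j = i then int (m choose (2 * i - 1)) else 0)" for j
    by (auto simp: coeff_of_nat_mult m)
  have "coeff (f2 n) i = 2 * ((\<Sum>j\<le>n. if j = i then int (m choose (2 * i + 1)) else 0)
        - (\<Sum>j\<le>n. if Suc j = i then int (m choose (2 * i - 1)) else 0))
        + 2 * (\<Sum>j\<le>n. if j = i then int (n choose (2 * i)) else 0)"
    unfolding f2_def coeff_add coeff_two coeff_sum summand sum_subtractf
    by (simp add: coeff_of_nat_mult if_distrib cong: if_cong)
  \<comment> \<open>Pascal on \<open>n choose (2 * i)\<close> cancels
    \<open>m choose (2 * i - 1)\<close>; the remaining two terms recombine. For \<open>i > n\<close>
    all binomials vanish.\<close>
  also have "\<dots> = 2 * int (n choose (2 * i + 1))"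
  proof (cases i)
    case 0
    then show ?thesis
      by (simp add: m)
  next
    case (Suc k)
    then show ?thesis
      by (auto simp: m binomial_eq_0)
  qed
  finally show ?thesis .
qed

theorem theorem5p3:
  fixes n N :: nat
  assumes "n \<ge> 6" and "even n" and "N = n div 2 - 1"
  shows "degree (C_poly n) < N \<and> coterm N (cyclic_class N (C_poly n))"
proof -
  have n: "n = 2 * N + 2" and N: "N \<ge> 2"
    using assms by auto
  have coeff_C: "coeff (C_poly n) i = (if i < N then 2 * int (n choose (2 * i + 1)) else 0)" for i
  proof -
    have "coeff (C_poly n) i
        = 2 * int (n choose (2 * i + 1)) - (if i = N then 2 * int n else 0)"
      by (simp add: C_poly_def coeff_f2 n)
    moreover have "n choose (2 * N + 1) = n"
      using binomial_symmetric[of 1 n] n by simp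
    moreover have "n choose (2 * i + 1) = 0" if "i > N"
      using that n by (intro binomial_eq_0) auto
    ultimately show ?thesis
      by (cases i N rule: linorder_cases) auto
  qed
  have "degree (C_poly n) \<le> N - 1"
    by (rule degree_le) (use N in \<open>auto simp: coeff_C\<close>)
  moreover have "C_poly n = (\<Sum>i<N. monom (coeff (C_poly n) i) i)"
    by (rule poly_eqI) (simp add: coeff_sum coeff_C)
  \<comment> \<open>Since \<open>1 \<le> i\<close>, also \<open>N - i < N\<close>, so both
    coefficients are binomial ones in \<open>coeff_C\<close>.\<close>
  moreover have "coeff (C_poly n) i = coeff (C_poly n) (N - i)" if "1 \<le> i" "i \<le> N div 2" for i
  proof -
    have "n choose (2 * i + 1) = n choose (n - (2 * i + 1))"
      using that n by (intro binomial_symmetric) auto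
    also have "n - (2 * i + 1) = 2 * (N - i) + 1"
      using that n by auto
    finally show ?thesis
      using that by (simp add: coeff_C)
  qed
  ultimately show ?thesis
    using N unfolding coterm_def by (intro conjI exI[of _ "coeff (C_poly n)"]) auto
qed

end
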